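(* There are constants $c_1,c_2>0$ such that for all integers $s,n$ with $4 \leq s \leq c_2 n$, $$\log r_3(s,n) \geq c_1 \, s n \, \log (n/s).$$
   Context: $r_3(s,n)$ denotes the minimum $N$ such that every red-blue coloring of the unordered triples of an $N$-element set contains either a red set of size $s$ or a blue set of size $n$, where a set is called red (blue) if all triples from this set are red (blue). Here $\log$ is the natural logarithm. *)

theory Defs
  imports Complex_Main "HOL-Library.Ramsey"
begin

text \<open>In \<^term>\<open>partn_lst {..<N} [s, n] 3\<close> a coloring maps the triples of
  \<^term>\<open>{..<N}\<close> to 0 (red) or 1 (blue). The value is not junk: see \<open>ramsey3\<close>
  below. The choice of the \<open>N\<close>-element set is immaterial: see \<open>partn_lst_red_blue_iff\<close>.\<close>

definition r3 :: "nat \<Rightarrow> nat \<Rightarrow> nat" where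
  "r3 s n = (LEAST N. partn_lst {..<N} [s, n] 3)"

lemma ramsey3: "partn_lst {..<r3 s n} [s, n] 3"
  unfolding r3_def by (rule LeastI_ex) (rule ramsey_full)

lemma r3_le_iff: "r3 s n \<le> N \<longleftrightarrow> partn_lst {..<N} [s, n] 3"
  using ramsey3 partn_lst_greater_resource Least_le unfolding r3_def by metis

lemma partn_lst_red_blue_iff:
  fixes V :: "'a set"
  assumes V: "finite V" "card V = N"
  shows "partn_lst {..<N} [s, n] 3 \<longleftrightarrow>
    (\<forall>red :: 'a set \<Rightarrow> bool.
       (\<exists>S \<subseteq> V. card S = s \<and> (\<forall>T \<in> [S]\<^bsup>3\<^esup>. red T)) \<or>
       (\<exists>S \<subseteq> V. card S = n \<and> (\<forall>T \<in> [S]\<^bsup>3\<^esup>. \<not> red T)))"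
  (is "?L \<longleftrightarrow> (\<forall>red. ?R red)")
proof
  obtain h where h: "bij_betw h {..<N} V"
    using V ex_bij_betw_nat_finite[of V] by (auto simp: atLeast0LessThan)
  then have inj: "inj_on h {..<N}" and im: "h ` {..<N} = V"
    by (auto simp: bij_betw_def)
  show "\<forall>red. ?R red" if ?L
  proof
    fix red :: "'a set \<Rightarrow> bool"
    have mono: "\<exists>S \<subseteq> V. card S = k \<and> (\<forall>T \<in> [S]\<^bsup>3\<^esup>. P T)"
      if H: "H \<in> [{..<N}]\<^bsup>k\<^esup>" and P: "\<And>U. U \<in> [H]\<^bsup>3\<^esup> \<Longrightarrow> P (h ` U)" for H k P
    proof (intro exI[of _ "h ` H"] conjI ballI)
      have HN: "H \<subseteq> {..<N}" using H by (auto simp: nsets_def)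
      show "h ` H \<subseteq> V" using HN im by blast
      show "card (h ` H) = k"
        using H inj_on_subset[OF inj HN] by (simp add: nsets_def card_image)
      fix T assume "T \<in> [h ` H]\<^bsup>3\<^esup>"
      then obtain U where "U \<in> [H]\<^bsup>3\<^esup>" "T = h ` U"
        using nset_image_obtains[of T h H 3] inj_on_subset[OF inj HN] by blast
      then show "P T" using P by blast
    qed
    define f where "f = (\<lambda>U. if red (h ` U) then 0 else 1::nat)"
    have "f \<in> [{..<N}]\<^bsup>3\<^esup> \<rightarrow> {..<2}" by (auto simp: f_def)
    then obtain i H where i: "i < 2" and H: "H \<in> [{..<N}]\<^bsup>([s, n] ! i)\<^esup>"
      and fH: "f ` [H]\<^bsup>3\<^esup> \<subseteq> {i}"
      using \<open>?L\<close> by (auto simp: partn_lst_def monochromatic_def numeral_2_eq_2)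
    consider "i = 0" | "i = 1" using i by linarith
    then show "?R red"
    proof cases
      case 1
      have "red (h ` U)" if "U \<in> [H]\<^bsup>3\<^esup>" for U
        using fH that 1 unfolding f_def by (auto split: if_splits)
      then show ?thesis using mono[of H s red] H 1 by auto
    next
      case 2
      have "\<not> red (h ` U)" if "U \<in> [H]\<^bsup>3\<^esup>" for U
        using fH that 2 unfolding f_def by (auto split: if_splits)
      then show ?thesis using mono[of H n "\<lambda>T. \<not> red T"] H 2 by auto
    qed
  qed
  define g where "g = inv_into {..<N} h"
  have g: "bij_betw g V {..<N}" unfolding g_def by (rule bij_betw_inv_into[OF h])
  have gh: "h ` (g ` T) = T" if "T \<subseteq> V" for T
    unfolding g_def using that im by (simp add: image_inv_into_cancel)
  show ?L if R: "\<forall>red. ?R red"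
    unfolding partn_lst_def
  proof (intro ballI)
    fix f assume f: "f \<in> [{..<N}]\<^bsup>3\<^esup> \<rightarrow> {..<length [s, n]}"
    have mono: "monochromatic {..<N} k 3 f i"
      if S: "S \<subseteq> V" "card S = k" and P: "\<And>T. T \<in> [S]\<^bsup>3\<^esup> \<Longrightarrow> f (g ` T) = i" for S k i
    proof -
      have injS: "inj_on g S" using g S by (meson bij_betw_def inj_on_subset)
      have "finite S" using S V finite_subset by blast
      then have "g ` S \<in> [{..<N}]\<^bsup>k\<^esup>"
        using S injS g by (auto simp: nsets_def card_image bij_betw_def)
      moreover have "f ` [g ` S]\<^bsup>3\<^esup> \<subseteq> {i}"
        using P nset_image_obtains[of _ g S 3] injS by blast
      ultimately show ?thesis unfolding monochromatic_def by blast
    qed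
    have "?R (\<lambda>T. f (g ` T) = 0)" using R by blast
    then show "\<exists>i<length [s, n]. monochromatic {..<N} ([s, n] ! i) 3 f i"
    proof (elim disjE exE conjE)
      fix S assume "S \<subseteq> V" "card S = s" "\<forall>T\<in>[S]\<^bsup>3\<^esup>. f (g ` T) = 0"
      then have "monochromatic {..<N} s 3 f 0" using mono by blast
      then show ?thesis by (intro exI[of _ 0]) simp
    next
      fix S assume S: "S \<subseteq> V" "card S = n" and b: "\<forall>T\<in>[S]\<^bsup>3\<^esup>. f (g ` T) \<noteq> 0"
      have "f (g ` T) = 1" if T: "T \<in> [S]\<^bsup>3\<^esup>" for T
      proof -
        have TV: "T \<subseteq> V" using T S by (auto simp: nsets_def)
        then have "inj_on g T" using g by (meson bij_betw_def inj_on_subset)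
        then have "g ` T \<in> [{..<N}]\<^bsup>3\<^esup>"
          using T TV g by (auto simp: nsets_def card_image bij_betw_def)
        then have "f (g ` T) < 2" using f by (auto simp: numeral_2_eq_2)
        then show ?thesis using b T by fastforce
      qed
      then have "monochromatic {..<N} n 3 f 1" using mono S by blast
      then show ?thesis by (intro exI[of _ 1]) simp
    qed
  qed
qed

end

theory Submission
  imports Defs
begin

text \<open>Put \<open>k = s - 1\<close>. The deletion method gives a graph on a set \<open>U\<close> of \<open>L\<close> vertices, with \<open>L\<close>
  about \<open>(n/s)\<close> to the power of order \<open>k\<close>, that has no clique of size \<open>k\<close> and no independent set of
  size \<open>m\<close>, where \<open>m\<close> is a small constant multiple of \<open>n\<close>. Label the pairs of vertices
  \<open>a < x\<close> of the \<open>N\<close>-element set with random elements \<open>\<chi> (a, x)\<close> of \<open>U\<close>, and colour a triple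
  \<open>a < x < y\<close> red if \<open>\<chi> (a, x)\<close> and \<open>\<chi> (a, y)\<close> are adjacent. The labels at the least element of a
  red \<open>s\<close>-set would form a clique of size \<open>k\<close>, so there is no red \<open>s\<close>-set. In a blue set of size \<open>2h\<close>,
  every element \<open>a\<close> of the lower half sends the whole upper half into an independent set, hence into
  some \<open>m\<close>-subset of \<open>U\<close>; this has probability at most \<open>(L choose m)^h (m/L)^(h*h)\<close>, so the union
  bound allows \<open>N\<close> up to about \<open>(L/m)\<close> to the power of order \<open>h\<close>.\<close>

section \<open>The first moment method in counting form\<close>

text \<open>The values of a uniformly random map at distinct points are independent, so the
  constraints at the points of \<open>A\<close>, each of probability \<open>t / card S\<close>,
  multiply. As a count this works because the restricted maps again form a dependent
  product.\<close>

lemma card_PiE_restricted: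
  assumes "finite E" "A \<subseteq> E" "finite S" "S \<noteq> {}"
    and T: "\<And>e. e \<in> A \<Longrightarrow> T e \<subseteq> S \<and> card (T e) = t"
  shows "real (card {f \<in> E \<rightarrow>\<^sub>E S. \<forall>e\<in>A. f e \<in> T e})
    = (real t / real (card S)) ^ card A * real (card (E \<rightarrow>\<^sub>E S))"
proof -
  have "{f \<in> E \<rightarrow>\<^sub>E S. \<forall>e\<in>A. f e \<in> T e} = (\<Pi>\<^sub>E e\<in>E. if e \<in> A then T e else S)"
    using T assms(2) by (auto simp: PiE_iff extensional_def split: if_splits) blast+
  moreover have "(\<Prod>e\<in>E. card (if e \<in> A then T e else S))
      = (\<Prod>e\<in>A. card (T e)) * (\<Prod>e\<in>E - A. card S)"
    using prod.subset_diff[OF assms(2,1), of "\<lambda>e. card (if e \<in> A then T e else S)"]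
    by simp
  ultimately have "card {f \<in> E \<rightarrow>\<^sub>E S. \<forall>e\<in>A. f e \<in> T e} = t ^ card A * card S ^ card (E - A)"
    using T assms(1) by (simp add: card_PiE)
  moreover have "card (E \<rightarrow>\<^sub>E S) = card S ^ card A * card S ^ card (E - A)"
    using card_mono[OF assms(1,2)] assms finite_subset[OF assms(2,1)]
    by (simp add: card_funcsetE card_Diff_subset flip: power_add)
  moreover have "card S > 0" using assms by (simp add: card_gt_0_iff)
  ultimately show ?thesis by (simp add: power_divide)
qed

lemma choose_le_power: "(n choose r) \<le> n ^ r"
proof (cases "r \<le> n")
  case True
  then show ?thesis by (rule binomial_le_pow)
qed (simp add: binomial_eq_0)

lemma exists_less_one_of_sum_less_card:
  fixes w :: "'a \<Rightarrow> real"
  assumes "(\<Sum>x\<in>F. w x) < real (card F)"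
  shows "\<exists>x\<in>F. w x < 1"
proof (rule ccontr)
  assume "\<not> ?thesis"
  then have "(\<Sum>x\<in>F. 1) \<le> (\<Sum>x\<in>F. w x)" by (intro sum_mono) force
  with assms show False by simp
qed

text \<open>Linearity of expectation: after exchanging the two sums, each \<open>k\<close>-set
  contributes the probability that all its pairs receive colours in \<open>T\<close>. The choices
  \<open>{0}\<close> and \<open>{1..<q}\<close> of \<open>T\<close> will count cliques and
  independent sets.\<close>

lemma sum_card_nsets_PiE:
  fixes V :: "'a set"
  assumes V: "finite V" and "finite S" "S \<noteq> {}" "T \<subseteq> S"
  shows "(\<Sum>f\<in>[V]\<^bsup>2\<^esup> \<rightarrow>\<^sub>E S. real (card {K \<in> [V]\<^bsup>k\<^esup>. \<forall>e\<in>[K]\<^bsup>2\<^esup>. f e \<in> T}))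
    = real (card V choose k) * (real (card T) / real (card S)) ^ (k choose 2)
      * real (card ([V]\<^bsup>2\<^esup> \<rightarrow>\<^sub>E S))"
proof -
  let ?F = "[V]\<^bsup>2\<^esup> \<rightarrow>\<^sub>E S"
  have fin: "finite ?F" "finite ([V]\<^bsup>k\<^esup>)" "finite ([V]\<^bsup>2\<^esup>)"
    using assms by (auto intro!: finite_PiE finite_imp_finite_nsets)
  have "(\<Sum>f\<in>?F. real (card {K \<in> [V]\<^bsup>k\<^esup>. \<forall>e\<in>[K]\<^bsup>2\<^esup>. f e \<in> T}))
      = (\<Sum>f\<in>?F. \<Sum>K\<in>[V]\<^bsup>k\<^esup>. if \<forall>e\<in>[K]\<^bsup>2\<^esup>. f e \<in> T then 1 else 0)"
    using fin by (simp add: sum.If_cases Int_def)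
  also have "\<dots> = (\<Sum>K\<in>[V]\<^bsup>k\<^esup>. \<Sum>f\<in>?F. if \<forall>e\<in>[K]\<^bsup>2\<^esup>. f e \<in> T then 1 else 0)"
    by (rule sum.swap)
  also have "\<dots> = (\<Sum>K\<in>[V]\<^bsup>k\<^esup>. real (card {f \<in> ?F. \<forall>e\<in>[K]\<^bsup>2\<^esup>. f e \<in> T}))"
    using fin by (simp add: sum.If_cases Int_def)
  also have "\<dots> = (\<Sum>K\<in>[V]\<^bsup>k\<^esup>. (real (card T) / real (card S)) ^ (k choose 2) * real (card ?F))"
  proof (rule sum.cong[OF refl])
    fix K assume K: "K \<in> [V]\<^bsup>k\<^esup>"
    then have "K \<subseteq> V" "card K = k" "finite K" by (auto simp: nsets_def)
    then have "[K]\<^bsup>2\<^esup> \<subseteq> [V]\<^bsup>2\<^esup>" "card ([K]\<^bsup>2\<^esup>) = k choose 2"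
      by (auto simp: nsets_mono card_nsets)
    then show "real (card {f \<in> ?F. \<forall>e\<in>[K]\<^bsup>2\<^esup>. f e \<in> T})
        = (real (card T) / real (card S)) ^ (k choose 2) * real (card ?F)"
      using card_PiE_restricted[of "[V]\<^bsup>2\<^esup>" "[K]\<^bsup>2\<^esup>" S "\<lambda>_. T" "card T"] assms fin by auto
  qed
  finally show ?thesis using V by (simp add: card_nsets)
qed

section \<open>A graph from the deletion method\<close>

text \<open>Removing one element of each member of \<open>C\<close> destroys them all and costs at
  most \<open>card C\<close> elements; \<open>k > 0\<close> ensures that there is an element to
  remove.\<close>

lemma finite_deletion:
  assumes U: "finite U" and C: "C \<subseteq> [U]\<^bsup>k\<^esup>" "k > 0" and "card C + L \<le> card U"
  obtains W where "W \<subseteq> U" "card W = L" "\<And>K. K \<in> C \<Longrightarrow> \<not> K \<subseteq> W"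
proof -
  have "K \<noteq> {}" if "K \<in> C" for K using that C by (auto simp: nsets_def)
  then have "\<forall>K\<in>C. \<exists>x. x \<in> K" by blast
  then obtain r where r: "\<And>K. K \<in> C \<Longrightarrow> r K \<in> K" by metis
  have finC: "finite C" using C U finite_subset finite_imp_finite_nsets by metis
  have "card (r ` C) \<le> card C" using finC card_image_le by blast
  then have "L \<le> card (U - r ` C)"
    using assms(4) diff_card_le_card_Diff[of "r ` C" U] finC by simp
  then obtain W where "W \<subseteq> U - r ` C" "card W = L" by (meson obtain_subset_with_card_n)
  then show ?thesis using that[of W] r by blast
qed

text \<open>On \<open>2 * L\<close> vertices, \<open>small\<close> bounds the mean of (number of
  \<open>k\<close>-cliques) / \<open>L\<close> + (number of independent \<open>m\<close>-sets). Some
  outcome is below 1, hence has fewer than \<open>L\<close> cliques and no independent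
  \<open>m\<close>-set. Deleting a vertex of each clique leaves \<open>L\<close> vertices, and
  passing to a subset creates no new independent set.\<close>

lemma exists_graph_no_clique_no_independent:
  fixes k m q L :: nat
  assumes "q > 0" "k > 0" "L > 0"
    and small: "real (2 * L choose k) * (1 / real q) ^ (k choose 2) / real L
      + real (2 * L choose m) * (1 - 1 / real q) ^ (m choose 2) < 1"
  obtains U :: "nat set" and G where "finite U" "card U = L"
    "\<And>K. K \<in> [U]\<^bsup>k\<^esup> \<Longrightarrow> \<not> [K]\<^bsup>2\<^esup> \<subseteq> G" "\<And>I. I \<in> [U]\<^bsup>m\<^esup> \<Longrightarrow> [I]\<^bsup>2\<^esup> \<inter> G \<noteq> {}"
proof -
  define V where "V = {..<2 * L}"
  have V: "finite V" "card V = 2 * L" by (auto simp: V_def)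
  let ?F = "[V]\<^bsup>2\<^esup> \<rightarrow>\<^sub>E {..<q}"
  \<comment> \<open>Colour 0 out of \<open>q\<close> marks the edges of the graph, so the edge probability is \<open>1 / q\<close>.\<close>
  define cl where "cl f = {K \<in> [V]\<^bsup>k\<^esup>. \<forall>e\<in>[K]\<^bsup>2\<^esup>. f e \<in> {0::nat}}" for f
  define ind where "ind f = {I \<in> [V]\<^bsup>m\<^esup>. \<forall>e\<in>[I]\<^bsup>2\<^esup>. f e \<in> {1..<q}}" for f
  have F: "real (card ?F) > 0" using assms(1) V
    by (simp add: card_funcsetE finite_imp_finite_nsets)
  have "{Suc 0..<q} \<subseteq> {..<q}" by auto
  then have "(\<Sum>f\<in>?F. real (card (cl f)) / real L + real (card (ind f)))
      = (real (2 * L choose k) * (1 / real q) ^ (k choose 2) / real L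
         + real (2 * L choose m) * ((real q - 1) / real q) ^ (m choose 2)) * real (card ?F)"
    using sum_card_nsets_PiE[of V "{..<q}" "{0}" k] sum_card_nsets_PiE[of V "{..<q}" "{1..<q}" m]
      assms(1) V unfolding cl_def ind_def
    by (simp add: sum.distrib lessThan_empty_iff distrib_right of_nat_diff flip: sum_divide_distrib)
  also have "\<dots> < 1 * real (card ?F)"
    using small assms(1) F by (intro mult_strict_right_mono) (simp_all add: diff_divide_distrib)
  finally have "(\<Sum>f\<in>?F. real (card (cl f)) / real L + real (card (ind f))) < real (card ?F)"
    by simp
  then obtain f where f: "f \<in> ?F" "real (card (cl f)) / real L + real (card (ind f)) < 1"
    using exists_less_one_of_sum_less_card by blast
  have "real (card (ind f)) < 1" "real (card (cl f)) / real L < 1"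
    using f(2) by (smt (verit) divide_nonneg_nonneg of_nat_0_le_iff)+
  moreover have "finite (ind f)" unfolding ind_def using V by (simp add: finite_imp_finite_nsets)
  ultimately have ind: "ind f = {}" and cl: "card (cl f) < L" using assms(3) by auto
  obtain U where U: "U \<subseteq> V" "card U = L" "\<And>K. K \<in> cl f \<Longrightarrow> \<not> K \<subseteq> U"
    using finite_deletion[of V "cl f" k L] cl V assms(2) unfolding cl_def by auto
  show ?thesis
  proof (rule that[of U "{e. f e = 0}"])
    show "finite U" using U V finite_subset by blast
    show "card U = L" by fact
    show "\<not> [K]\<^bsup>2\<^esup> \<subseteq> {e. f e = 0}" if "K \<in> [U]\<^bsup>k\<^esup>" for K
      using that U unfolding cl_def nsets_def by blast
    show "[I]\<^bsup>2\<^esup> \<inter> {e. f e = 0} \<noteq> {}" if I: "I \<in> [U]\<^bsup>m\<^esup>" for I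
    proof
      assume e: "[I]\<^bsup>2\<^esup> \<inter> {e. f e = 0} = {}"
      have "f e \<in> {1..<q}" if "e \<in> [I]\<^bsup>2\<^esup>" for e
      proof -
        have "e \<in> [V]\<^bsup>2\<^esup>" using that I U(1) unfolding nsets_def by blast
        then have "f e < q" using f(1) by auto
        moreover have "e \<notin> {e. f e = 0}" using e that by blast
        ultimately show ?thesis by auto
      qed
      moreover have "I \<in> [V]\<^bsup>m\<^esup>" using I U(1) unfolding nsets_def by blast
      ultimately show False using ind unfolding ind_def by blast
    qed
  qed
qed

section \<open>Random labels on pairs\<close>

text \<open>A union bound over all ways to fail. Labels sit on ordered pairs, so a rectangle of
  sides \<open>h\<close> carries \<open>h * h\<close> independent labels even if \<open>A\<close>
  and \<open>B\<close> overlap.\<close>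

lemma exists_map_scattering_rectangles:
  fixes U :: "'a set" and V :: "'b set"
  assumes "finite U" "finite V" "h > 0"
    and small: "(card V)\<^sup>2 * (card U choose m) * m ^ h < card U ^ h"
  obtains \<chi> where "\<chi> \<in> V \<times> V \<rightarrow>\<^sub>E U"
    "\<And>A B. A \<in> [V]\<^bsup>h\<^esup> \<Longrightarrow> B \<in> [V]\<^bsup>h\<^esup> \<Longrightarrow> \<exists>a\<in>A. \<forall>M\<in>[U]\<^bsup>m\<^esup>. \<not> (\<lambda>b. \<chi> (a, b)) ` B \<subseteq> M"
proof -
  let ?N = "card V" and ?L = "card U"
  let ?F = "V \<times> V \<rightarrow>\<^sub>E U"
  have L: "?L > 0" using small assms(3) by (cases "?L") (auto simp: zero_power)
  then have U0: "U \<noteq> {}" by auto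
  \<comment> \<open>A failure is witnessed by two \<open>h\<close>-sets and a choice
    \<open>\<phi>\<close> of an \<open>m\<close>-set for each row \<open>a\<close> that contains all
    labels of that row; \<open>bad d\<close> collects the labellings witnessed by
    \<open>d\<close>.\<close>
  define D where "D = (SIGMA AB:[V]\<^bsup>h\<^esup> \<times> [V]\<^bsup>h\<^esup>. fst AB \<rightarrow>\<^sub>E [U]\<^bsup>m\<^esup>)"
  define bad where "bad = (\<lambda>((A, B), \<phi>). {\<chi> \<in> ?F. \<forall>e\<in>A \<times> B. \<chi> e \<in> \<phi> (fst e)})"
  have finF: "finite ?F" using assms by (simp add: finite_PiE)
  have finA: "finite A" if "A \<in> [V]\<^bsup>h\<^esup>" for A using that unfolding nsets_def by blast
  have finD: "finite D" unfolding D_def using assms finA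
    by (intro finite_SigmaI finite_cartesian_product finite_imp_finite_nsets)
       (auto intro!: finite_PiE finite_imp_finite_nsets)
  have "card D = (\<Sum>AB\<in>[V]\<^bsup>h\<^esup> \<times> [V]\<^bsup>h\<^esup>. card (fst AB \<rightarrow>\<^sub>E [U]\<^bsup>m\<^esup>))"
    unfolding D_def using assms finA
    by (subst card_SigmaI) (auto intro!: finite_PiE finite_imp_finite_nsets)
  also have "\<dots> = (\<Sum>AB\<in>[V]\<^bsup>h\<^esup> \<times> [V]\<^bsup>h\<^esup>. (?L choose m) ^ h)"
  proof (rule sum.cong[OF refl])
    fix AB assume "AB \<in> [V]\<^bsup>h\<^esup> \<times> [V]\<^bsup>h\<^esup>"
    then have "finite (fst AB)" "card (fst AB) = h" by (auto simp: nsets_def)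
    then show "card (fst AB \<rightarrow>\<^sub>E [U]\<^bsup>m\<^esup>) = (?L choose m) ^ h" by (simp add: card_funcsetE)
  qed
  also have "\<dots> = (?N choose h)\<^sup>2 * (?L choose m) ^ h"
    using assms by (simp add: card_cartesian_product card_nsets power2_eq_square)
  finally have cardD: "card D = (?N choose h)\<^sup>2 * (?L choose m) ^ h" .
  have bad: "real (card (bad d)) = (real m / real ?L) ^ (h * h) * real (card ?F)" if "d \<in> D" for d
  proof -
    obtain A B \<phi> where d: "d = ((A, B), \<phi>)" "A \<in> [V]\<^bsup>h\<^esup>" "B \<in> [V]\<^bsup>h\<^esup>" "\<phi> \<in> A \<rightarrow>\<^sub>E [U]\<^bsup>m\<^esup>"
      using \<open>d \<in> D\<close> unfolding D_def by auto
    have "A \<times> B \<subseteq> V \<times> V" "card (A \<times> B) = h * h"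
      using d by (auto simp: nsets_def card_cartesian_product)
    moreover have "\<phi> (fst e) \<subseteq> U \<and> card (\<phi> (fst e)) = m" if "e \<in> A \<times> B" for e
    proof -
      have "\<phi> (fst e) \<in> [U]\<^bsup>m\<^esup>" using d that by auto
      then show ?thesis by (auto simp: nsets_def)
    qed
    ultimately show ?thesis
      using card_PiE_restricted[of "V \<times> V" "A \<times> B" U "\<lambda>e. \<phi> (fst e)" m] assms U0
      unfolding d bad_def by simp
  qed
  have "real (card (\<Union>d\<in>D. bad d)) \<le> (\<Sum>d\<in>D. real (card (bad d)))"
    using card_UN_le[OF finD, of bad] by (simp flip: of_nat_sum)
  also have "\<dots> = real (card D) * ((real m / real ?L) ^ (h * h) * real (card ?F))"
    using bad by simp
  also have "\<dots> \<le> real ((?N ^ h)\<^sup>2 * (?L choose m) ^ h) * ((real m / real ?L) ^ (h * h) * real (card ?F))"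
    unfolding cardD by (intro mult_right_mono) (auto intro!: mult_right_mono power_mono choose_le_power)
  \<comment> \<open>The whole bound is an \<open>h\<close>-th power, whose base is the quotient of
    the two sides of \<open>small\<close>.\<close>
  also have "\<dots> = (real (?N\<^sup>2 * (?L choose m) * m ^ h) / real (?L ^ h)) ^ h * real (card ?F)"
    by (simp add: power_mult_distrib power_divide mult.commute flip: power_mult)
  also have "\<dots> < 1 * real (card ?F)"
  proof (rule mult_strict_right_mono)
    have "real (?N\<^sup>2 * (?L choose m) * m ^ h) / real (?L ^ h) < 1"
      using small L by (subst divide_less_eq_1_pos) (simp_all only: of_nat_less_iff of_nat_0_less_iff zero_less_power)
    then show "(real (?N\<^sup>2 * (?L choose m) * m ^ h) / real (?L ^ h)) ^ h < 1"
      using assms(3) by (intro power_less_one_iff[THEN iffD2]) auto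
    show "real (card ?F) > 0" using L assms by (simp add: card_funcsetE)
  qed
  finally have "card (\<Union>d\<in>D. bad d) < card ?F" by simp
  moreover have "(\<Union>d\<in>D. bad d) \<subseteq> ?F" unfolding bad_def by auto
  ultimately have "(\<Union>d\<in>D. bad d) \<subset> ?F" by (metis less_irrefl psubsetI)
  then obtain \<chi> where \<chi>: "\<chi> \<in> ?F" "\<chi> \<notin> (\<Union>d\<in>D. bad d)"
    using psubset_imp_ex_mem DiffD1 DiffD2 by metis
  show ?thesis
  proof (rule that[OF \<chi>(1)], rule ccontr)
    fix A B assume AB: "A \<in> [V]\<^bsup>h\<^esup>" "B \<in> [V]\<^bsup>h\<^esup>"
      and "\<not> (\<exists>a\<in>A. \<forall>M\<in>[U]\<^bsup>m\<^esup>. \<not> (\<lambda>b. \<chi> (a, b)) ` B \<subseteq> M)"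
    then have "\<forall>a\<in>A. \<exists>M. M \<in> [U]\<^bsup>m\<^esup> \<and> (\<lambda>b. \<chi> (a, b)) ` B \<subseteq> M" by blast
    then obtain \<phi> where \<phi>: "\<And>a. a \<in> A \<Longrightarrow> \<phi> a \<in> [U]\<^bsup>m\<^esup> \<and> (\<lambda>b. \<chi> (a, b)) ` B \<subseteq> \<phi> a"
      by metis
    have "((A, B), restrict \<phi> A) \<in> D" unfolding D_def using AB \<phi> by auto
    moreover have "\<chi> \<in> bad ((A, B), restrict \<phi> A)" unfolding bad_def using \<chi>(1) \<phi> by auto
    ultimately show False using \<chi>(2) by blast
  qed
qed

section \<open>From graph and labels to a colouring of triples\<close>

lemma split_halves:
  fixes S :: "nat set"
  assumes "finite S" "2 * h \<le> card S"
  obtains A B where "A \<subseteq> S" "B \<subseteq> S" "card A = h" "card B = h" "\<And>a b. a \<in> A \<Longrightarrow> b \<in> B \<Longrightarrow> a < b"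
proof -
  let ?xs = "sorted_list_of_set S"
  have len: "length ?xs = card S" by simp
  have sd: "sorted ?xs" "distinct ?xs" "set ?xs = S" using assms by auto
  let ?A = "set (take h ?xs)" and ?B = "set (take h (drop h ?xs))"
  show ?thesis
  proof (rule that[of ?A ?B])
    show "?A \<subseteq> S" using sd set_take_subset by metis
    show "?B \<subseteq> S" using sd set_take_subset set_drop_subset by (metis subset_trans)
    show "card ?A = h" "card ?B = h" using sd assms len by (simp_all add: distinct_card)
    fix a b assume ab: "a \<in> ?A" "b \<in> ?B"
    then have b: "b \<in> set (drop h ?xs)" using set_take_subset by fast
    have "sorted (take h ?xs @ drop h ?xs)" "distinct (take h ?xs @ drop h ?xs)"
      using sd by simp_all
    then have "a \<le> b" "a \<noteq> b" using ab b unfolding sorted_append distinct_append by blast+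
    then show "a < b" by simp
  qed
qed

text \<open>The clique bound excludes red sets; one vertex, the least, is spent on reading off
  labels, hence \<open>Suc k\<close>. Independence together with scattering excludes blue
  sets.\<close>

lemma r3_gt_of_graph:
  fixes U :: "'a set"
  assumes "finite U" "h > 0" "2 * h \<le> n" "m \<le> card U"
    and clique: "\<And>K. K \<in> [U]\<^bsup>k\<^esup> \<Longrightarrow> \<not> [K]\<^bsup>2\<^esup> \<subseteq> G"
    and indep: "\<And>I. I \<in> [U]\<^bsup>m\<^esup> \<Longrightarrow> [I]\<^bsup>2\<^esup> \<inter> G \<noteq> {}"
    and small: "N\<^sup>2 * (card U choose m) * m ^ h < card U ^ h"
  shows "N < r3 (Suc k) n"
proof (rule ccontr)
  assume "\<not> N < r3 (Suc k) n"
  then have part: "partn_lst {..<N} [Suc k, n] 3" using r3_le_iff[of "Suc k" n N] by simp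
  define V where "V = {..<N}"
  have V: "finite V" "card V = N" by (auto simp: V_def)
  obtain \<chi> where \<chi>: "\<chi> \<in> V \<times> V \<rightarrow>\<^sub>E U"
    "\<And>A B. A \<in> [V]\<^bsup>h\<^esup> \<Longrightarrow> B \<in> [V]\<^bsup>h\<^esup> \<Longrightarrow> \<exists>a\<in>A. \<forall>M\<in>[U]\<^bsup>m\<^esup>. \<not> (\<lambda>b. \<chi> (a, b)) ` B \<subseteq> M"
    using exists_map_scattering_rectangles[of U V h m] assms(1,2) small V by metis
  \<comment> \<open>The pair tested consists of the labels of the two larger vertices at the least
    one. \<open>G\<close> may contain sets that are not pairs; the intersection with the pairs of
    \<open>U\<close> forces the two labels of a red triple to differ, which gives injectivity in the
    red case.\<close>
  define red where "red T \<longleftrightarrow> (\<lambda>x. \<chi> (Min T, x)) ` (T - {Min T}) \<in> G \<inter> [U]\<^bsup>2\<^esup>" for T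
  have red: "red {a, x, y} \<longleftrightarrow> {\<chi> (a, x), \<chi> (a, y)} \<in> G \<inter> [U]\<^bsup>2\<^esup>"
    if "a < x" "a < y" for a x y
  proof -
    have "Min {a, x, y} = a" using that by simp
    moreover have "{a, x, y} - {a} = {x, y}" using that by auto
    ultimately show ?thesis unfolding red_def by simp
  qed
  have trip: "{a, x, y} \<in> [S]\<^bsup>3\<^esup>" if "a < x" "a < y" "x \<noteq> y" "a \<in> S" "x \<in> S" "y \<in> S"
    for a x y :: nat and S
    using that by (auto simp: nsets_def)
  consider S where "S \<subseteq> V" "card S = Suc k" "\<forall>T\<in>[S]\<^bsup>3\<^esup>. red T"
    | S where "S \<subseteq> V" "card S = n" "\<forall>T\<in>[S]\<^bsup>3\<^esup>. \<not> red T"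
    using partn_lst_red_blue_iff[OF V, of "Suc k" n] part by blast
  then show False
  proof cases
    case (1 S)
    define a where "a = Min S"
    define g where "g x = \<chi> (a, x)" for x
    have finS: "finite S" using 1 V finite_subset by blast
    have aS: "a \<in> S" unfolding a_def using 1 finS by (intro Min_in) auto
    have less: "a < x" if "x \<in> S - {a}" for x
      using that finS unfolding a_def by (simp add: order_less_le)
    have pair: "{g x, g y} \<in> G \<inter> [U]\<^bsup>2\<^esup>" if "x \<in> S - {a}" "y \<in> S - {a}" "x \<noteq> y" for x y
      using red[of a x y] trip[of a x y S] less that aS 1(3) unfolding g_def by auto
    have inj: "inj_on g (S - {a})"
    proof (rule inj_onI, rule ccontr)
      fix x y assume "x \<in> S - {a}" "y \<in> S - {a}" "g x = g y" "x \<noteq> y"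
      then show False using pair[of x y] by (simp add: nsets_def)
    qed
    have "g ` (S - {a}) \<subseteq> U" using \<chi>(1) aS 1(1) unfolding g_def by auto
    then have K: "g ` (S - {a}) \<in> [U]\<^bsup>k\<^esup>"
      using 1(2) aS finS inj by (simp add: nsets_def card_image)
    have "[g ` (S - {a})]\<^bsup>2\<^esup> \<subseteq> G"
    proof
      fix e assume "e \<in> [g ` (S - {a})]\<^bsup>2\<^esup>"
      then obtain u v where "e = {u, v}" "u \<in> g ` (S - {a})" "v \<in> g ` (S - {a})" "u \<noteq> v"
        by (rule nsets2_E)
      then obtain x y where "e = {g x, g y}" "x \<in> S - {a}" "y \<in> S - {a}" "x \<noteq> y" by blast
      then show "e \<in> G" using pair[of x y] by simp
    qed
    with clique[OF K] show False by blast
  next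
    case (2 S)
    have finS: "finite S" using 2 V finite_subset by blast
    obtain A B where AB: "A \<subseteq> S" "B \<subseteq> S" "card A = h" "card B = h"
      and less: "\<And>a b. a \<in> A \<Longrightarrow> b \<in> B \<Longrightarrow> a < b"
      using split_halves[OF finS, of h] 2 assms(3) by metis
    have fin: "finite A" "finite B" using AB finS finite_subset by auto
    have "A \<in> [V]\<^bsup>h\<^esup>" "B \<in> [V]\<^bsup>h\<^esup>" using AB 2(1) fin by (auto simp: nsets_def)
    then have "\<exists>a\<in>A. \<forall>M\<in>[U]\<^bsup>m\<^esup>. \<not> (\<lambda>b. \<chi> (a, b)) ` B \<subseteq> M" by (rule \<chi>(2))
    then obtain a where a: "a \<in> A" and M: "\<forall>M\<in>[U]\<^bsup>m\<^esup>. \<not> (\<lambda>b. \<chi> (a, b)) ` B \<subseteq> M"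
      by (rule bexE)
    let ?C = "(\<lambda>b. \<chi> (a, b)) ` B"
    have CU: "?C \<subseteq> U" using \<chi>(1) a AB 2(1) by auto
    have nG: "e \<notin> G" if "e \<in> [?C]\<^bsup>2\<^esup>" for e
    proof -
      obtain u v where uv: "e = {u, v}" "u \<in> ?C" "v \<in> ?C" "u \<noteq> v"
        using \<open>e \<in> [?C]\<^bsup>2\<^esup>\<close> by (rule nsets2_E)
      then obtain x y where xy: "x \<in> B" "y \<in> B" "x \<noteq> y" "u = \<chi> (a, x)" "v = \<chi> (a, y)" by blast
      have "{a, x, y} \<in> [S]\<^bsup>3\<^esup>" by (rule trip) (use less a xy AB in auto)
      then have "\<not> red {a, x, y}" using 2 by blast
      moreover have "e \<in> [U]\<^bsup>2\<^esup>" using that CU unfolding nsets_def by blast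
      ultimately show ?thesis using red[of a x y] less a xy uv by auto
    qed
    \<comment> \<open>No pair of labels in \<open>?C\<close> lies in \<open>G\<close>. With at least
      \<open>m\<close> labels this contradicts \<open>indep\<close>; fewer labels fit into an
      \<open>m\<close>-subset of \<open>U\<close>, since \<open>m \<le> card U\<close>, contrary to
      scattering.\<close>
    show False
    proof (cases "m \<le> card ?C")
      case True
      then obtain I where I: "I \<subseteq> ?C" "card I = m" "finite I" by (meson obtain_subset_with_card_n)
      then have "I \<in> [U]\<^bsup>m\<^esup>" using CU by (auto simp: nsets_def)
      then have "[I]\<^bsup>2\<^esup> \<inter> G \<noteq> {}" by (rule indep)
      moreover have "[I]\<^bsup>2\<^esup> \<subseteq> [?C]\<^bsup>2\<^esup>" using I unfolding nsets_def by blast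
      ultimately show False using nG by blast
    next
      case False
      then obtain M' where "?C \<subseteq> M'" "M' \<subseteq> U" "card M' = m"
        using exists_subset_between[of ?C m U] CU assms(1,4) by auto
      moreover from this have "M' \<in> [U]\<^bsup>m\<^esup>"
        using assms(1) finite_subset by (auto simp: nsets_def)
      ultimately show False using M by simp
    qed
  qed
qed

section \<open>Estimates for the parameters\<close>

text \<open>The parameters are integral powers of one number \<open>b\<close>, of order \<open>(n/s)^(1/12)\<close>: the edge
  probability is \<open>b^-10\<close>, slightly above the reciprocal of \<open>m/k = b^12\<close> so that independent
  \<open>m\<close>-sets are rare, while for \<open>L = b^(5k-1)\<close> the expected number of \<open>k\<close>-cliques is
  still less than \<open>L\<close>, so that deletion leaves enough vertices.\<close>

lemma clique_bound:
  fixes b k L :: nat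
  assumes "k \<ge> 3" "b \<ge> 20" "L = b ^ (5 * k - 1)"
  shows "real (2 * L choose k) * (1 / real (b ^ 10)) ^ (k choose 2) / real L \<le> 1 / 4"
proof -
  have b: "real b \<ge> 20" using assms by simp
  obtain j where k: "k = Suc j" "j \<ge> 2" using assms(1) by (cases k) auto
  have "2 * (k choose 2) = k * j" unfolding choose_two k by simp
  then have ex: "10 * (k choose 2) = 5 * k * j" by simp
  have "(2 * L choose k) \<le> (2 * L) ^ k" by (rule choose_le_power)
  then have "real (2 * L choose k) \<le> real ((2 * L) ^ k)" by (simp only: of_nat_le_iff)
  then have le: "real (2 * L choose k) \<le> 2 ^ k * real L ^ j * real L"
    by (simp add: k power_mult_distrib mult_ac)
  \<comment> \<open>The reason for the \<open>- 1\<close> in the exponent of \<open>L\<close>: with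
    \<open>b ^ (5 * k)\<close> the powers of \<open>b\<close> would balance exactly, and the missing
    factor \<open>b\<close> yields the surplus \<open>b ^ j\<close> that beats
    \<open>2 ^ k\<close>.\<close>
  have Lj: "real L ^ j * real b ^ j = real b ^ (5 * k * j)"
  proof -
    have "L * b = b ^ (5 * k)" using assms(3) k by (simp flip: power_Suc2)
    then have "(L * b) ^ j = b ^ (5 * k * j)" by (simp add: power_mult)
    then show ?thesis by (metis of_nat_power of_nat_mult power_mult_distrib)
  qed
  have "(1 / real (b ^ 10)) ^ (k choose 2) = 1 / real b ^ (10 * (k choose 2))"
    by (simp add: power_divide flip: power_mult)
  also have "\<dots> = 1 / real b ^ (5 * k * j)" by (simp only: ex)
  also have "\<dots> = 1 / (real L ^ j * real b ^ j)" by (simp add: Lj)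
  finally have eq: "(1 / real (b ^ 10)) ^ (k choose 2) = 1 / (real L ^ j * real b ^ j)" .
  have "real (2 * L choose k) * (1 / real (b ^ 10)) ^ (k choose 2) / real L
      \<le> (2 ^ k * real L ^ j * real L) * (1 / (real L ^ j * real b ^ j)) / real L"
    unfolding eq by (intro divide_right_mono mult_right_mono le) auto
  also have "\<dots> = 2 * (2 / real b) ^ j"
    using assms by (simp add: k power_divide)
  also have "\<dots> \<le> 2 * (1 / 10) ^ j"
    using b by (intro mult_left_mono power_mono) (auto simp: field_simps)
  also have "\<dots> \<le> 2 * (1 / 10) ^ 2"
    using k by (intro mult_left_mono power_decreasing) auto
  finally show ?thesis by (simp add: power2_eq_square)
qed

text \<open>The quotient \<open>m / b ^ 10 = k * b ^ 2\<close> dominates \<open>ln L\<close>, which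
  is of order \<open>k * ln b\<close>. Hence an \<open>m\<close>-set is independent with probability
  at most \<open>(1 / (4 * L)) ^ m\<close>, against at most \<open>(2 * L) ^ m\<close> such
  sets.\<close>

lemma independent_bound:
  fixes b k L m :: nat
  assumes "k \<ge> 3" "b \<ge> 20" "L = b ^ (5 * k - 1)" "m = k * b ^ 12"
  shows "real (2 * L choose m) * (1 - 1 / real (b ^ 10)) ^ (m choose 2) \<le> 1 / 2"
proof -
  have b: "real b \<ge> 20" using assms by simp
  have m: "m \<ge> 2" using assms by (simp add: mult_le_mono[of 2 k 1 "b ^ 12", simplified])
  have "2 * (m choose 2) = m * (m - 1)" by (cases m) (simp_all add: choose_two)
  then have "real (2 * (m choose 2)) = real (m * (m - 1))" by (simp only:)
  then have m2: "real (m choose 2) = real m * (real m - 1) / 2" using m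
    by (simp add: of_nat_diff)
  have "1 - 1 / real (b ^ 10) \<le> exp (- (1 / real (b ^ 10)))"
    using exp_ge_add_one_self[of "- (1 / real (b ^ 10))"] by simp
  moreover have "0 \<le> 1 - 1 / real (b ^ 10)" using assms by (simp add: field_simps)
  ultimately have "(1 - 1 / real (b ^ 10)) ^ (m choose 2) \<le> exp (- (1 / real (b ^ 10))) ^ (m choose 2)"
    by (rule power_mono)
  also have "\<dots> = exp (- ((real m - 1) / (2 * real b ^ 10))) ^ m"
    by (simp add: m2 field_simps flip: exp_of_nat_mult)
  also have "\<dots> \<le> (1 / real (4 * L)) ^ m"
  proof (rule power_mono)
    have "real (4 * L) \<le> real b ^ (5 * k)"
    proof -
      have "b ^ (5 * k) = b * L" using assms(1,3) by (simp flip: power_Suc)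
      moreover have "4 * L \<le> b * L" using assms(2) by simp
      ultimately show ?thesis by (metis of_nat_le_iff of_nat_power)
    qed
    also have "\<dots> = exp (real (5 * k) * ln (real b))"
      using b exp_of_nat_mult[of "5 * k" "ln (real b)"] by simp
    also have "\<dots> \<le> exp ((real m - 1) / (2 * real b ^ 10))"
    proof -
      have "ln (real b) \<le> real b" using b ln_le_minus_one[of "real b"] by simp
      then have "real (5 * k) * ln (real b) \<le> 5 * real k * real b"
        using mult_left_mono[of "ln (real b)" "real b" "real (5 * k)"] by simp
      \<comment> \<open>For positive \<open>b\<close>, \<open>5 * b \<le> b ^ 2 / 4\<close> holds
        exactly when \<open>b \<ge> 20\<close>.\<close>
      also have "\<dots> \<le> real k * (real b)\<^sup>2 / 4"
        using b mult_right_mono[of 20 "real b" "real k * real b"]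
        by (simp add: power2_eq_square mult_ac)
      also have "\<dots> = real m / 2 / (2 * real b ^ 10)"
        using b unfolding assms(4) by (simp add: field_simps flip: power_add)
      also have "\<dots> \<le> (real m - 1) / (2 * real b ^ 10)"
        using m by (intro divide_right_mono) auto
      finally show ?thesis by simp
    qed
    finally have "real (4 * L) \<le> exp ((real m - 1) / (2 * real b ^ 10))" .
    moreover have "real (4 * L) > 0" using assms by simp
    ultimately show "exp (- ((real m - 1) / (2 * real b ^ 10))) \<le> 1 / real (4 * L)"
      by (simp add: exp_minus field_simps)
  qed simp
  finally have p: "(1 - 1 / real (b ^ 10)) ^ (m choose 2) \<le> (1 / real (4 * L)) ^ m" .
  have "(2 * L choose m) \<le> (2 * L) ^ m" by (rule choose_le_power)
  then have "real (2 * L choose m) \<le> real (2 * L) ^ m" by (metis of_nat_le_iff of_nat_power)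
  then have "real (2 * L choose m) * (1 - 1 / real (b ^ 10)) ^ (m choose 2)
      \<le> real (2 * L) ^ m * (1 / real (4 * L)) ^ m"
    using p by (intro mult_mono) (use \<open>0 \<le> 1 - 1 / real (b ^ 10)\<close> in auto)
  also have "\<dots> = (real (2 * L) * (1 / real (4 * L))) ^ m" by (rule power_mult_distrib[symmetric])
  also have "real (2 * L) * (1 / real (4 * L)) = 1 / 2" using assms by simp
  also have "(1 / 2 :: real) ^ m \<le> (1 / 2) ^ 1" using m by (intro power_decreasing) auto
  finally show ?thesis by simp
qed

text \<open>Take \<open>h = 24 * m\<close>; two halves of this size explain the factor 48. With
  \<open>L choose m\<close> replaced by \<open>L ^ m\<close>, both sides of the smallness condition
  are \<open>m\<close>-th powers, so it reduces to
  \<open>b ^ (4 * k) * m ^ 24 < L ^ 23\<close>.\<close>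

lemma r3_gt_power:
  fixes b k n :: nat
  assumes k: "k \<ge> 3" and b: "b \<ge> 20" and n: "48 * (k * b ^ 12) \<le> n"
  shows "b ^ (2 * k * (k * b ^ 12)) < r3 (Suc k) n"
proof -
  define m where "m = k * b ^ 12"
  define L where "L = b ^ (5 * k - 1)"
  have pos: "m > 0" "L > 0" using k b by (auto simp: m_def L_def)
  have "real (2 * L choose k) * (1 / real (b ^ 10)) ^ (k choose 2) / real L
      + real (2 * L choose m) * (1 - 1 / real (b ^ 10)) ^ (m choose 2) < 1"
    using clique_bound[OF k b L_def] independent_bound[OF k b L_def m_def] by linarith
  moreover have "b ^ 10 > 0" "k > 0" using k b by auto
  ultimately obtain U :: "nat set" and G where U: "finite U" "card U = L"
    and G: "\<And>K. K \<in> [U]\<^bsup>k\<^esup> \<Longrightarrow> \<not> [K]\<^bsup>2\<^esup> \<subseteq> G" "\<And>I. I \<in> [U]\<^bsup>m\<^esup> \<Longrightarrow> [I]\<^bsup>2\<^esup> \<inter> G \<noteq> {}"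
    using exists_graph_no_clique_no_independent[of "b ^ 10" k L m] pos(2) by metis
  \<comment> \<open>Fourth powers turn \<open>2 ^ k\<close> into \<open>16 ^ k \<le> b ^ k\<close>;
    this absorbs the factor \<open>k ^ 24\<close> of \<open>m ^ 24\<close> into
    \<open>b ^ (6 * k)\<close>.\<close>
  have "k \<le> 2 ^ k" by (simp add: less_imp_le)
  then have "k ^ 4 \<le> (2 ^ k) ^ 4" by (rule power_mono) simp
  also have "(2 ^ k) ^ 4 = ((2::nat) ^ 4) ^ k" by (simp only: mult.commute flip: power_mult)
  also have "\<dots> \<le> b ^ k" using b by (intro power_mono) simp_all
  finally have k4: "k ^ 4 \<le> b ^ k" .
  then have "(k ^ 4) ^ 6 \<le> (b ^ k) ^ 6" by (rule power_mono) simp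
  then have k24: "k ^ 24 \<le> b ^ (6 * k)" by (simp add: mult.commute flip: power_mult)
  have "b ^ (4 * k) * m ^ 24 = b ^ (4 * k + 288) * k ^ 24"
    unfolding m_def by (simp add: power_mult_distrib power_add flip: power_mult)
  also have "\<dots> \<le> b ^ (4 * k + 288) * b ^ (6 * k)" using k24 by simp
  also have "\<dots> = b ^ (10 * k + 288)" by (simp flip: power_add)
  \<comment> \<open>The exponents are \<open>10 * k + 288\<close> and \<open>115 * k - 23\<close>;
    at \<open>k = 3\<close> they are 318 and 322, while \<open>k = 2\<close> would fail.\<close>
  also have "\<dots> < b ^ ((5 * k - 1) * 23)" using k b by (intro power_strict_increasing) auto
  also have "\<dots> = L ^ 23" unfolding L_def by (simp add: power_mult)
  finally have key: "b ^ (4 * k) * m ^ 24 < L ^ 23" .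
  then have "(b ^ (4 * k) * L * m ^ 24) < L * L ^ 23" using pos by simp
  then have key2: "b ^ (4 * k) * L * m ^ 24 < L ^ 24" by (simp flip: power_Suc)
  show ?thesis unfolding m_def[symmetric]
  proof (rule r3_gt_of_graph[OF U(1) _ _ _ G, of "24 * m"])
    show "0 < 24 * m" using pos by simp
    show "2 * (24 * m) \<le> n" using n m_def by simp
    have "1 * m ^ 24 \<le> b ^ (4 * k) * m ^ 24" using b by (intro mult_le_mono1) simp
    then have "m ^ 24 < L ^ 23" using key by linarith
    also have "\<dots> \<le> L ^ 24" using pos by (intro power_increasing) auto
    finally show "m \<le> card U" unfolding U(2) using power_less_imp_less_base[of m 24 L] by simp
    have "(b ^ (2 * k * m))\<^sup>2 * (L choose m) * m ^ (24 * m)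
        \<le> (b ^ (2 * k * m))\<^sup>2 * L ^ m * m ^ (24 * m)"
      by (intro mult_le_mono choose_le_power) auto
    also have "\<dots> = (b ^ (4 * k) * L * m ^ 24) ^ m"
      by (simp add: power_mult_distrib mult_ac flip: power_mult)
    also have "\<dots> < (L ^ 24) ^ m" using key2 pos by (intro power_strict_mono) auto
    finally show "(b ^ (2 * k * m))\<^sup>2 * (card U choose m) * m ^ (24 * m) < card U ^ (24 * m)"
      unfolding U(2) by (simp add: power_mult)
  qed
qed

section \<open>Rounding to a power of \<open>b\<close> and taking logarithms\<close>

lemma exists_floor_root:
  fixes x :: real
  assumes "x \<ge> real a ^ p" "p > 0"
  obtains b :: nat where "b \<ge> a" "real b ^ p \<le> x" "x < real (Suc b) ^ p"
proof -
  define b where "b = nat \<lfloor>root p x\<rfloor>"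
  have x: "x \<ge> 0" using assms(1) by (meson of_nat_0_le_iff order_trans zero_le_power)
  have r0: "root p x \<ge> 0" using x assms(2) by (simp add: real_root_ge_zero)
  have ra: "root p x \<ge> real a"
    using assms real_root_le_mono[OF assms(2) assms(1)] by (simp add: real_root_power_cancel)
  have b: "real b \<le> root p x" "root p x < real (Suc b)" unfolding b_def using r0 by linarith+
  have rp: "root p x ^ p = x" using x assms(2) by simp
  show ?thesis
  proof (rule that[of b])
    show "b \<ge> a" unfolding b_def using ra by (simp add: le_nat_floor)
    show "real b ^ p \<le> x" using b(1) rp power_mono[of "real b" "root p x" p] by simp
    show "x < real (Suc b) ^ p" using b(2) rp r0 assms(2) power_strict_mono[of "root p x" "real (Suc b)" p] by simp
  qed
qed

theorem theorem1p3:
  shows "\<exists>c\<^sub>1 c\<^sub>2 :: real. c\<^sub>1 > 0 \<and> c\<^sub>2 > 0 \<and>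
    (\<forall>s n :: nat. 4 \<le> s \<and> real s \<le> c\<^sub>2 * real n \<longrightarrow>
      ln (real (r3 s n)) \<ge> c\<^sub>1 * real s * real n * ln (real n / real s))"
proof (rule exI[of _ "1 / 10 ^ 7"], rule exI[of _ "1 / (48 * 20 ^ 12)"], intro conjI allI impI)
  fix s n :: nat
  assume sn: "4 \<le> s \<and> real s \<le> 1 / (48 * 20 ^ 12) * real n"
  define k where "k = s - 1"
  have k: "k \<ge> 3" "s = Suc k" using sn by (auto simp: k_def)
  have "real k * (48 * 20 ^ 12) \<le> real s * (48 * 20 ^ 12)" using k by simp
  also have "\<dots> \<le> real n" using sn by (simp add: field_simps)
  \<comment> \<open>The value of \<open>c\<^sub>2\<close> is chosen for this bound, which makes the
    rounded twelfth root \<open>b\<close> at least 20.\<close>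
  finally have "real n / (48 * real k) \<ge> real 20 ^ 12" using k by (simp add: field_simps)
  then obtain b :: nat where b: "b \<ge> 20" "real b ^ 12 \<le> real n / (48 * real k)"
    "real n / (48 * real k) < real (Suc b) ^ 12"
    by (rule exists_floor_root) auto
  have "48 * (real k * real b ^ 12) \<le> real n" using b(2) k by (simp add: field_simps)
  then have "real (48 * (k * b ^ 12)) \<le> real n" by simp
  then have "48 * (k * b ^ 12) \<le> n" by (simp only: of_nat_le_iff)
  then have "b ^ (2 * k * (k * b ^ 12)) < r3 s n" unfolding k(2) by (rule r3_gt_power[OF k(1) b(1)])
  then have "real (b ^ (2 * k * (k * b ^ 12))) \<le> real (r3 s n)" by (simp only: of_nat_le_iff less_imp_le)
  then have "ln (real (b ^ (2 * k * (k * b ^ 12)))) \<le> ln (real (r3 s n))"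
    using b(1) by (intro ln_mono) auto
  then have low: "2 * real k * (real k * real b ^ 12) * ln (real b) \<le> ln (real (r3 s n))"
    using b(1) by (simp add: ln_realpow mult_ac)
  \<comment> \<open>Rounding loses at most a factor \<open>2 ^ 12 = 4096\<close>, and
    \<open>48 * 4096 = 196608\<close>.\<close>
  have "real (Suc b) ^ 12 \<le> (2 * real b) ^ 12" using b(1) by (intro power_mono) auto
  then have "real n / (48 * real k) \<le> 4096 * real b ^ 12" using b(3) by (simp add: power_mult_distrib)
  then have nb: "real n \<le> 196608 * (real k * real b ^ 12)" using k by (simp add: field_simps)
  have lnb: "ln (real b) \<ge> 0" using b(1) by simp
  have "real n / real s \<le> real n / real k" using k by (intro divide_left_mono) auto
  \<comment> \<open>The constant 196608 is below \<open>20 ^ 5\<close>, so five further powers of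
    \<open>b\<close> absorb it and \<open>ln (n / s)\<close> is at most
    \<open>17 * ln b\<close>.\<close>
  also have "\<dots> \<le> 20 ^ 5 * real b ^ 12" using nb k by (simp add: field_simps)
  also have "\<dots> \<le> real b ^ 5 * real b ^ 12" using b(1) by (intro mult_right_mono power_mono) auto
  finally have "real n / real s \<le> real b ^ 17" by (simp flip: power_add)
  moreover have "real n / real s > 0" using sn by (auto intro!: divide_pos_pos gr0I)
  ultimately have "ln (real n / real s) \<le> ln (real b ^ 17)" using b(1) by (subst ln_le_cancel_iff) auto
  then have ln17: "ln (real n / real s) \<le> 17 * ln (real b)" using b(1) by (simp add: ln_realpow)
  have "real s * real n \<le> (2 * real k) * (196608 * (real k * real b ^ 12))"
    using nb k by (intro mult_mono) auto
  then have "real s * real n * ln (real n / real s)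
      \<le> (2 * real k) * (196608 * (real k * real b ^ 12)) * (17 * ln (real b))"
    using ln17 lnb
    by (meson mult_left_mono mult_right_mono mult_nonneg_nonneg of_nat_0_le_iff order_trans
        zero_le_numeral)
  \<comment> \<open>The source of \<open>c\<^sub>1\<close>: \<open>196608 * 17 = 3342336\<close> is
    below \<open>10 ^ 7\<close>.\<close>
  also have "\<dots> \<le> 10 ^ 7 * (2 * real k * (real k * real b ^ 12) * ln (real b))"
  proof -
    have "0 \<le> real k * (real k * real b ^ 12) * ln (real b)" using lnb by simp
    then show ?thesis by (simp add: mult_ac)
  qed
  also have "\<dots> \<le> 10 ^ 7 * ln (real (r3 s n))" by (rule mult_left_mono[OF low]) simp
  finally show "1 / 10 ^ 7 * real s * real n * ln (real n / real s) \<le> ln (real (r3 s n))"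
    by simp
qed auto

end
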